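(* Let $\hat\Pi_t=\hat\sigma_t(M_t)$, $t=0,\dots,T$, be an approximate information state, with parameters $\epsilon_T$ and $\delta_t$ ($t=0,\dots,T-1$), for the terminal-cost minimax control problem described in the context. For $t=0,\dots,T-1$ let $L_{\hat V_{t+1}}$ be a Lipschitz constant of $\hat V_{t+1}(\cdot)$. Then, for all $t=0,\dots,T$, all $m_t\in\mathcal{M}_t$ and all $u_t\in\mathcal{U}_t$, $$|Q_t(m_t,u_t)-\hat Q_t(\hat\sigma_t(m_t),u_t)|\le\alpha_t,\qquad |V_t(m_t)-\hat V_t(\hat\sigma_t(m_t))|\le\alpha_t,$$ where $\alpha_T=\epsilon_T$ and $\alpha_t=\alpha_{t+1}+L_{\hat V_{t+1}}\cdot\delta_t$ for all $t=0,\dots,T-1$.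
   Context: System. Fix a horizon $T\in\mathbb{N}$ and finite nonempty sets $\mathcal{X}_t,\mathcal{U}_t,\mathcal{W}_t,\mathcal{N}_t,\mathcal{Y}_t$ ($t=0,\dots,T$). The state evolves as $X_{t+1}=f_t(X_t,U_t,W_t)\in\mathcal{X}_{t+1}$ for $t=0,\dots,T-1$ from $X_0\in\mathcal{X}_0$, with disturbance $W_t\in\mathcal{W}_t$ and action $U_t\in\mathcal{U}_t$; the observation is $Y_t=h_t(X_t,N_t)\in\mathcal{Y}_t$ with noise $N_t\in\mathcal{N}_t$. The primitive variables $X_0,W_t,N_t$ are independent in the non-stochastic sense: their joint range is the full product $\mathcal{X}_0\times\prod_t\mathcal{W}_t\times\prod_t\mathcal{N}_t$. The memory at time $t$ is $M_t=(Y_{0:t},U_{0:t-1})$, where $Y_{0:t}=(Y_0,\dots,Y_t)$. The terminal cost is $c_T(X_T,U_T)$ with $c_T:\mathcal{X}_T\times\mathcal{U}_T\to\mathbb{R}_{\ge 0}$. Ranges. All quantities are uncertain variables, i.e. functions on a sample space $\Omega$ without any probability distribution. Here $\Omega$ is the set of all tuples $\omega=(x_0,w_{0:T},n_{0:T},u_{0:T})$ with $x_0\in\mathcal{X}_0$, $w_t\in\mathcal{W}_t$, $n_t\in\mathcal{N}_t$, $u_t\in\mathcal{U}_t$ (actions arbitrary). The conditional range of $X$ given a realization $y$ of $Y$ is $[[X|y]]:=\{X(\omega): \omega\in\Omega,\ Y(\omega)=y\}$; similarly when conditioning on several realizations jointly. $\mathcal{M}_t$ is the set of realizations of $M_t$,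 $\mathcal{M}_t=\{M_t(\omega):\omega\in\Omega\}$. Hausdorff metric. For nonempty finite subsets $\mathcal{A},\mathcal{B}$ of a metric space with metric $d$, $\mathcal{H}(\mathcal{A},\mathcal{B}):=\max\{\max_{a\in\mathcal{A}}\min_{b\in\mathcal{B}}d(a,b),\ \max_{b\in\mathcal{B}}\min_{a\in\mathcal{A}}d(a,b)\}$. Memory-based value functions. $Q_T(m_T,u_T):=\max_{x_T\in[[X_T|m_T]]}c_T(x_T,u_T)$; for $t=0,\dots,T-1$, $Q_t(m_t,u_t):=\max_{m_{t+1}\in[[M_{t+1}|m_t,u_t]]}V_{t+1}(m_{t+1})$; and $V_t(m_t):=\min_{u_t\in\mathcal{U}_t}Q_t(m_t,u_t)$ for $t=0,\dots,T$. Approximate information state. A family $\hat\Pi_t=\hat\sigma_t(M_t)$, $t=0,\dots,T$, with $\hat\sigma_t:\mathcal{M}_t\to\hat{\mathcal{P}}_t$ and $\hat{\mathcal{P}}_t$ a finite metric space, is an approximate information state with parameters $\epsilon_T,\delta_t\in\mathbb{R}_{\ge0}$ if: (1) for all $m_T\in\mathcal{M}_T$, $u_T\in\mathcal{U}_T$, $|\max_{x_T\in[[X_T|m_T]]}c_T(x_T,u_T)-\max_{x_T\in[[X_T|\hat\sigma_T(m_T)]]}c_T(x_T,u_T)|\le\epsilon_T$, where $[[X_T|\hat\pi_T]]$ is the conditional range given $\hat\Pi_T=\hat\pi_T$; (2) for all $t=0,\dots,T-1$, $m_t\in\mathcal{M}_t$, $u_t\in\mathcal{U}_t$, $\mathcal{H}\big([[\hat\Pi_{t+1}|m_t,u_t]],[[\hat\Pi_{t+1}|\hat\sigma_t(m_t),u_t]]\big)\le\delta_t$,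 where the second set conditions on $\hat\Pi_t=\hat\sigma_t(m_t)$ and $U_t=u_t$. Approximate value functions (for $\hat\pi_t$ in the range of $\hat\Pi_t$). $\hat Q_T(\hat\pi_T,u_T):=\max_{x_T\in[[X_T|\hat\pi_T]]}c_T(x_T,u_T)$; for $t=0,\dots,T-1$, $\hat Q_t(\hat\pi_t,u_t):=\max_{\hat\pi_{t+1}\in[[\hat\Pi_{t+1}|\hat\pi_t,u_t]]}\hat V_{t+1}(\hat\pi_{t+1})$; and $\hat V_t(\hat\pi_t):=\min_{u_t\in\mathcal{U}_t}\hat Q_t(\hat\pi_t,u_t)$ for $t=0,\dots,T$. *)

theory Defs
  imports "HOL-Analysis.Analysis"
begin

text \<open>
  The time-indexed sets, such as the state spaces \<open>X_t\<close>, are families of carrier sets inside one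
  type; they may be different for every \<open>t\<close>.
\<close>

record ('x, 'u, 'w, 'n, 'y) minimax_problem =
  horizon :: nat
  states :: "nat \<Rightarrow> 'x set"
  actions :: "nat \<Rightarrow> 'u set"
  disturbances :: "nat \<Rightarrow> 'w set"
  noises :: "nat \<Rightarrow> 'n set"
  observations :: "nat \<Rightarrow> 'y set"
  dynamics :: "nat \<Rightarrow> 'x \<Rightarrow> 'u \<Rightarrow> 'w \<Rightarrow> 'x"
  sensor :: "nat \<Rightarrow> 'x \<Rightarrow> 'n \<Rightarrow> 'y"
  terminal_cost :: "'x \<Rightarrow> 'u \<Rightarrow> real"

definition minimax_problem_wf :: "('x, 'u, 'w, 'n, 'y) minimax_problem \<Rightarrow> bool" where
  "minimax_problem_wf S \<longleftrightarrow>
     (\<forall>t\<le>horizon S.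
        finite (states S t) \<and> states S t \<noteq> {} \<and>
        finite (actions S t) \<and> actions S t \<noteq> {} \<and>
        finite (disturbances S t) \<and> disturbances S t \<noteq> {} \<and>
        finite (noises S t) \<and> noises S t \<noteq> {} \<and>
        finite (observations S t) \<and> observations S t \<noteq> {}) \<and>
     (\<forall>t<horizon S. \<forall>x\<in>states S t. \<forall>u\<in>actions S t. \<forall>w\<in>disturbances S t.
        dynamics S t x u w \<in> states S (Suc t)) \<and>
     (\<forall>t\<le>horizon S. \<forall>x\<in>states S t. \<forall>n\<in>noises S t. sensor S t x n \<in> observations S t) \<and>
     (\<forall>x\<in>states S (horizon S). \<forall>u\<in>actions S (horizon S). 0 \<le> terminal_cost S x u)"


text \<open>
  A sample is \<open>(x0, w, n, u)\<close>. The sample space is the full product, which encodes both the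
  non-stochastic independence of the primitive variables and the arbitrariness of the actions.
\<close>

type_synonym ('x, 'u, 'w, 'n) sample = "'x \<times> (nat \<Rightarrow> 'w) \<times> (nat \<Rightarrow> 'n) \<times> (nat \<Rightarrow> 'u)"

definition sample_space ::
    "('x, 'u, 'w, 'n, 'y) minimax_problem \<Rightarrow> ('x, 'u, 'w, 'n) sample set" where
  "sample_space S =
     states S 0 \<times> (\<Pi>\<^sub>E t\<in>{..horizon S}. disturbances S t)
       \<times> (\<Pi>\<^sub>E t\<in>{..horizon S}. noises S t) \<times> (\<Pi>\<^sub>E t\<in>{..horizon S}. actions S t)"

fun action_var :: "nat \<Rightarrow> ('x, 'u, 'w, 'n) sample \<Rightarrow> 'u" where
  "action_var t (x0, w, n, u) = u t"

fun state_var ::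
    "('x, 'u, 'w, 'n, 'y) minimax_problem \<Rightarrow> nat \<Rightarrow> ('x, 'u, 'w, 'n) sample \<Rightarrow> 'x" where
  "state_var S 0 (x0, w, n, u) = x0"
| "state_var S (Suc t) (x0, w, n, u) = dynamics S t (state_var S t (x0, w, n, u)) (u t) (w t)"

fun obs_var ::
    "('x, 'u, 'w, 'n, 'y) minimax_problem \<Rightarrow> nat \<Rightarrow> ('x, 'u, 'w, 'n) sample \<Rightarrow> 'y" where
  "obs_var S t (x0, w, n, u) = sensor S t (state_var S t (x0, w, n, u)) (n t)"

text \<open>The memory \<open>(Y_0, ..., Y_t)\<close>, \<open>(U_0, ..., U_(t-1))\<close>; the second list is empty for \<open>t = 0\<close>.\<close>

type_synonym ('u, 'y) memory = "'y list \<times> 'u list"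

definition mem_var ::
    "('x, 'u, 'w, 'n, 'y) minimax_problem \<Rightarrow> nat \<Rightarrow> ('x, 'u, 'w, 'n) sample \<Rightarrow> ('u, 'y) memory" where
  "mem_var S t \<omega> = (map (\<lambda>s. obs_var S s \<omega>) [0..<Suc t], map (\<lambda>s. action_var s \<omega>) [0..<t])"

definition memories :: "('x, 'u, 'w, 'n, 'y) minimax_problem \<Rightarrow> nat \<Rightarrow> ('u, 'y) memory set" where
  "memories S t = mem_var S t ` sample_space S"

text \<open>Conditioning jointly on several variables is conditioning on their tuple.\<close>

definition cond_range ::
    "('x, 'u, 'w, 'n, 'y) minimax_problem \<Rightarrow> (('x, 'u, 'w, 'n) sample \<Rightarrow> 'a)
       \<Rightarrow> (('x, 'u, 'w, 'n) sample \<Rightarrow> 'b) \<Rightarrow> 'b \<Rightarrow> 'a set" where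
  "cond_range S A B b = {A \<omega> |\<omega>. \<omega> \<in> sample_space S \<and> B \<omega> = b}"

definition mem_action_var ::
    "('x, 'u, 'w, 'n, 'y) minimax_problem \<Rightarrow> nat \<Rightarrow> ('x, 'u, 'w, 'n) sample \<Rightarrow> ('u, 'y) memory \<times> 'u" where
  "mem_action_var S t \<omega> = (mem_var S t \<omega>, action_var t \<omega>)"


text \<open>
  In the value functions below the terminal case is meant for \<open>t = horizon S\<close>; values at later
  times are irrelevant.
\<close>

function Q_mem ::
    "('x, 'u, 'w, 'n, 'y) minimax_problem \<Rightarrow> nat \<Rightarrow> ('u, 'y) memory \<Rightarrow> 'u \<Rightarrow> real"
  and V_mem ::
    "('x, 'u, 'w, 'n, 'y) minimax_problem \<Rightarrow> nat \<Rightarrow> ('u, 'y) memory \<Rightarrow> real" where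
  "Q_mem S t m u =
     (if t < horizon S
      then Max ((\<lambda>m'. V_mem S (Suc t) m') `
             cond_range S (mem_var S (Suc t)) (mem_action_var S t) (m, u))
      else Max ((\<lambda>x. terminal_cost S x u) `
             cond_range S (state_var S (horizon S)) (mem_var S (horizon S)) m))"
| "V_mem S t m = Min ((\<lambda>u. Q_mem S t m u) ` actions S t)"
  by pat_completeness auto
termination
  by (relation "Wellfounded.measure (case_sum (\<lambda>(S, t, m, u). 2 * (horizon S - t))
                                  (\<lambda>(S, t, m). 2 * (horizon S - t) + 1))") auto

declare Q_mem.simps [simp del] V_mem.simps [simp del]


definition hausdorff_dist :: "('a \<Rightarrow> 'a \<Rightarrow> real) \<Rightarrow> 'a set \<Rightarrow> 'a set \<Rightarrow> real" where
  "hausdorff_dist d A B =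
     max (Max ((\<lambda>a. Min ((\<lambda>b. d a b) ` B)) ` A)) (Max ((\<lambda>b. Min ((\<lambda>a. d a b) ` A)) ` B))"

definition info_var ::
    "('x, 'u, 'w, 'n, 'y) minimax_problem \<Rightarrow> (nat \<Rightarrow> ('u, 'y) memory \<Rightarrow> 'p)
       \<Rightarrow> nat \<Rightarrow> ('x, 'u, 'w, 'n) sample \<Rightarrow> 'p" where
  "info_var S \<sigma> t \<omega> = \<sigma> t (mem_var S t \<omega>)"

definition info_action_var ::
    "('x, 'u, 'w, 'n, 'y) minimax_problem \<Rightarrow> (nat \<Rightarrow> ('u, 'y) memory \<Rightarrow> 'p)
       \<Rightarrow> nat \<Rightarrow> ('x, 'u, 'w, 'n) sample \<Rightarrow> 'p \<times> 'u" where
  "info_action_var S \<sigma> t \<omega> = (info_var S \<sigma> t \<omega>, action_var t \<omega>)"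

text \<open>Each time \<open>t\<close> has its own metric space \<open>P t\<close>, with its own carrier and metric.\<close>

definition approx_info_state ::
    "('x, 'u, 'w, 'n, 'y) minimax_problem \<Rightarrow> (nat \<Rightarrow> 'p metric)
       \<Rightarrow> (nat \<Rightarrow> ('u, 'y) memory \<Rightarrow> 'p) \<Rightarrow> real \<Rightarrow> (nat \<Rightarrow> real) \<Rightarrow> bool" where
  "approx_info_state S P \<sigma> \<epsilon> \<delta> \<longleftrightarrow>
     (\<forall>t\<le>horizon S. finite (mspace (P t)) \<and> \<sigma> t \<in> memories S t \<rightarrow> mspace (P t)) \<and>
     0 \<le> \<epsilon> \<and> (\<forall>t<horizon S. 0 \<le> \<delta> t) \<and>
     (\<forall>m\<in>memories S (horizon S). \<forall>u\<in>actions S (horizon S).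
        \<bar>Max ((\<lambda>x. terminal_cost S x u) `
            cond_range S (state_var S (horizon S)) (mem_var S (horizon S)) m)
         - Max ((\<lambda>x. terminal_cost S x u) `
            cond_range S (state_var S (horizon S)) (info_var S \<sigma> (horizon S)) (\<sigma> (horizon S) m))\<bar>
        \<le> \<epsilon>) \<and>
     (\<forall>t<horizon S. \<forall>m\<in>memories S t. \<forall>u\<in>actions S t.
        hausdorff_dist (mdist (P (Suc t)))
          (cond_range S (info_var S \<sigma> (Suc t)) (mem_action_var S t) (m, u))
          (cond_range S (info_var S \<sigma> (Suc t)) (info_action_var S \<sigma> t) (\<sigma> t m, u))
        \<le> \<delta> t)"

function Q_info ::
    "('x, 'u, 'w, 'n, 'y) minimax_problem \<Rightarrow> (nat \<Rightarrow> ('u, 'y) memory \<Rightarrow> 'p)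
       \<Rightarrow> nat \<Rightarrow> 'p \<Rightarrow> 'u \<Rightarrow> real"
  and V_info ::
    "('x, 'u, 'w, 'n, 'y) minimax_problem \<Rightarrow> (nat \<Rightarrow> ('u, 'y) memory \<Rightarrow> 'p)
       \<Rightarrow> nat \<Rightarrow> 'p \<Rightarrow> real" where
  "Q_info S \<sigma> t p u =
     (if t < horizon S
      then Max ((\<lambda>p'. V_info S \<sigma> (Suc t) p') `
             cond_range S (info_var S \<sigma> (Suc t)) (info_action_var S \<sigma> t) (p, u))
      else Max ((\<lambda>x. terminal_cost S x u) `
             cond_range S (state_var S (horizon S)) (info_var S \<sigma> (horizon S)) p))"
| "V_info S \<sigma> t p = Min ((\<lambda>u. Q_info S \<sigma> t p u) ` actions S t)"
  by pat_completeness auto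
termination
  by (relation "Wellfounded.measure (case_sum (\<lambda>(S, \<sigma>, t, p, u). 2 * (horizon S - t))
                                  (\<lambda>(S, \<sigma>, t, p). 2 * (horizon S - t) + 1))") auto

declare Q_info.simps [simp del] V_info.simps [simp del]

text \<open>
  The analogue of \<^const>\<open>lipschitz_on\<close> for a metric that is not given by a type class. As there,
  the constant is nonnegative.
\<close>

definition lipschitz_const_on :: "'p metric \<Rightarrow> 'p set \<Rightarrow> ('p \<Rightarrow> real) \<Rightarrow> real \<Rightarrow> bool" where
  "lipschitz_const_on P A g L \<longleftrightarrow>
     0 \<le> L \<and> (\<forall>p\<in>A. \<forall>q\<in>A. \<bar>g p - g q\<bar> \<le> L * mdist P p q)"

end

theory Submission
  imports Defs
begin

text \<open>
  Backward induction on \<open>t\<close>. The conditional range of the information state at time \<open>t + 1\<close> given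
  \<open>(m, u)\<close> is the image of that of the memory, so replacing the memory value by the approximate
  value costs at most \<open>\<alpha> (t + 1)\<close>. Conditioning on \<open>(\<sigma> t m, u)\<close> instead of \<open>(m, u)\<close> then moves the
  maximum of an \<open>L\<close>-Lipschitz function by at most \<open>L\<close> times the Hausdorff distance. The two
  minima over actions differ by no more than the functions that are minimised.
\<close>

text \<open>Each value on one side has a partner within \<open>c\<close> on the other, so neither
  maximum can exceed the other by more than \<open>c\<close>. The index sets may differ: the partner
  is a nearby point in the Hausdorff estimate and the same memory in the induction step.\<close>

lemma abs_Max_image_diff_le:
  fixes f :: "'a \<Rightarrow> real" and g :: "'b \<Rightarrow> real"
  assumes "finite A" "A \<noteq> {}" "finite B" "B \<noteq> {}"
    and AB: "\<And>a. a \<in> A \<Longrightarrow> \<exists>b\<in>B. \<bar>f a - g b\<bar> \<le> c"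
    and BA: "\<And>b. b \<in> B \<Longrightarrow> \<exists>a\<in>A. \<bar>f a - g b\<bar> \<le> c"
  shows "\<bar>Max (f ` A) - Max (g ` B)\<bar> \<le> c"
proof -
  have "f a \<le> Max (g ` B) + c" if a: "a \<in> A" for a
  proof -
    obtain b where "b \<in> B" "\<bar>f a - g b\<bar> \<le> c"
      using AB[OF a] by blast
    moreover have "g b \<le> Max (g ` B)"
      using \<open>b \<in> B\<close> assms by simp
    ultimately show ?thesis by linarith
  qed
  then have "Max (f ` A) \<le> Max (g ` B) + c"
    using assms by simp
  moreover have "g b \<le> Max (f ` A) + c" if b: "b \<in> B" for b
  proof -
    obtain a where "a \<in> A" "\<bar>f a - g b\<bar> \<le> c"
      using BA[OF b] by blast
    moreover have "f a \<le> Max (f ` A)"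
      using \<open>a \<in> A\<close> assms by simp
    ultimately show ?thesis by linarith
  qed
  then have "Max (g ` B) \<le> Max (f ` A) + c"
    using assms by simp
  ultimately show ?thesis by linarith
qed

lemma abs_Min_image_diff_le:
  fixes f g :: "'a \<Rightarrow> real"
  assumes "finite A" "A \<noteq> {}" and close: "\<And>a. a \<in> A \<Longrightarrow> \<bar>f a - g a\<bar> \<le> c"
  shows "\<bar>Min (f ` A) - Min (g ` A)\<bar> \<le> c"
proof -
  have "Min (f ` A) - c \<le> g a" "Min (g ` A) - c \<le> f a" if "a \<in> A" for a
  proof -
    have "Min (f ` A) \<le> f a" "Min (g ` A) \<le> g a"
      using that assms by simp_all
    then show "Min (f ` A) - c \<le> g a" "Min (g ` A) - c \<le> f a"
      using close[OF that] by linarith+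
  qed
  then have "Min (f ` A) - c \<le> Min (g ` A)" "Min (g ` A) - c \<le> Min (f ` A)"
    using assms by simp_all
  then show ?thesis by linarith
qed

text \<open>A nearest point of \<open>B\<close> exists because \<open>B\<close> is finite, and its
  distance from \<open>a\<close> is one of the terms of the outer maximum.\<close>

lemma hausdorff_dist_left:
  assumes "finite A" "finite B" "B \<noteq> {}" "a \<in> A"
  obtains b where "b \<in> B" "d a b \<le> hausdorff_dist d A B"
proof -
  have "Min ((\<lambda>b. d a b) ` B) \<in> (\<lambda>b. d a b) ` B"
    using assms by (intro Min_in) auto
  then obtain b where b: "b \<in> B" "d a b = Min ((\<lambda>b. d a b) ` B)" by auto
  have "Min ((\<lambda>b. d a b) ` B) \<le> Max ((\<lambda>a. Min ((\<lambda>b. d a b) ` B)) ` A)"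
    using assms by (intro Max_ge) auto
  then have "d a b \<le> hausdorff_dist d A B"
    using b unfolding hausdorff_dist_def by simp
  with b that show ?thesis by blast
qed

text \<open>Flipping the arguments of \<open>d\<close> as well makes this hold without symmetry of
  \<open>d\<close>, so the right-hand version follows from the left-hand one.\<close>

lemma hausdorff_dist_swap:
  "hausdorff_dist (\<lambda>x y. d y x) B A = hausdorff_dist d A B"
  by (simp add: hausdorff_dist_def max.commute)

lemma hausdorff_dist_right:
  assumes "finite A" "finite B" "A \<noteq> {}" "b \<in> B"
  obtains a where "a \<in> A" "d a b \<le> hausdorff_dist d A B"
  using hausdorff_dist_left[of B A b "\<lambda>x y. d y x"] assms
  by (metis hausdorff_dist_swap)

lemma lipschitz_Max_diff_le:
  assumes "lipschitz_const_on P C g L"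
    and sub: "A \<subseteq> C" "B \<subseteq> C"
    and fin: "finite A" "A \<noteq> {}" "finite B" "B \<noteq> {}"
    and "hausdorff_dist (mdist P) A B \<le> r"
  shows "\<bar>Max (g ` A) - Max (g ` B)\<bar> \<le> L * r"
proof (rule abs_Max_image_diff_le[OF fin])
  have close: "\<bar>g a - g b\<bar> \<le> L * r"
    if "a \<in> A" "b \<in> B" "mdist P a b \<le> hausdorff_dist (mdist P) A B" for a b
  proof -
    have "\<bar>g a - g b\<bar> \<le> L * mdist P a b"
      using assms(1) that sub unfolding lipschitz_const_on_def by blast
    \<comment> \<open>Monotonicity needs \<open>0 \<le> L\<close>, which is part of
      \<open>lipschitz_const_on\<close>.\<close>
    also have "\<dots> \<le> L * r"
      using assms that unfolding lipschitz_const_on_def by (intro mult_left_mono) auto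
    finally show ?thesis .
  qed
  show "\<exists>b\<in>B. \<bar>g a - g b\<bar> \<le> L * r" if "a \<in> A" for a
    by (rule hausdorff_dist_left[where d = "mdist P", OF fin(1,3,4) that])
      (use close that in blast)
  show "\<exists>a\<in>A. \<bar>g a - g b\<bar> \<le> L * r" if "b \<in> B" for b
    by (rule hausdorff_dist_right[where d = "mdist P", OF fin(1,3,2) that])
      (use close that in blast)
qed

lemma finite_sample_space:
  assumes "minimax_problem_wf S"
  shows "finite (sample_space S)"
  using assms unfolding minimax_problem_wf_def sample_space_def
  by (intro finite_cartesian_product finite_PiE) auto

lemma finite_cond_range:
  assumes "minimax_problem_wf S"
  shows "finite (cond_range S A B b)"
proof -
  have "cond_range S A B b \<subseteq> A ` sample_space S"
    unfolding cond_range_def by auto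
  then show ?thesis
    using finite_sample_space[OF assms] finite_subset by blast
qed

lemma cond_range_nonempty: "\<omega> \<in> sample_space S \<Longrightarrow> B \<omega> = b \<Longrightarrow> cond_range S A B b \<noteq> {}"
  unfolding cond_range_def by blast

lemma cond_range_subset: "cond_range S A B b \<subseteq> A ` sample_space S"
  unfolding cond_range_def by auto

lemma cond_range_info_var:
  "cond_range S (info_var S \<sigma> t) B b = \<sigma> t ` cond_range S (mem_var S t) B b"
  unfolding cond_range_def info_var_def by blast

text \<open>Causality: the action at time \<open>t\<close> first influences the state at time
  \<open>t + 1\<close>.\<close>

lemma state_var_cong_actions:
  "(\<And>s. s < t \<Longrightarrow> u s = u' s) \<Longrightarrow> state_var S t (x, w, n, u) = state_var S t (x, w, n, u')"
  by (induction t) auto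

lemma mem_var_cong_actions:
  assumes "\<And>s. s < t \<Longrightarrow> u s = u' s"
  shows "mem_var S t (x, w, n, u) = mem_var S t (x, w, n, u')"
proof -
  have "state_var S s (x, w, n, u) = state_var S s (x, w, n, u')" if "s \<le> t" for s
    using that assms by (intro state_var_cong_actions) auto
  then show ?thesis
    using assms by (auto simp: mem_var_def)
qed

text \<open>Actions are free coordinates of the sample space, and the memory at time
  \<open>t\<close> records only earlier ones. Overwriting coordinate \<open>t\<close> therefore
  realises any action together with the given memory. This makes the conditional ranges nonempty and
  their maxima meaningful.\<close>

lemma ex_sample_mem_action:
  assumes "t \<le> horizon S" "m \<in> memories S t" "a \<in> actions S t"
  shows "\<exists>\<omega>\<in>sample_space S. mem_action_var S t \<omega> = (m, a)"
proof -
  obtain x w n u where \<omega>: "(x, w, n, u) \<in> sample_space S" "m = mem_var S t (x, w, n, u)"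
    using assms(2) unfolding memories_def by auto
  have "(x, w, n, u(t := a)) \<in> sample_space S"
    using \<omega>(1) assms unfolding sample_space_def by (auto simp: PiE_iff extensional_def)
  moreover have "mem_var S t (x, w, n, u(t := a)) = m"
    unfolding \<omega>(2) by (rule mem_var_cong_actions) simp
  ultimately show ?thesis
    by (auto simp: mem_action_var_def intro!: bexI[of _ "(x, w, n, u(t := a))"])
qed

lemma abs_V_diff_le:
  assumes "minimax_problem_wf S" "t \<le> horizon S"
    and "\<And>u. u \<in> actions S t \<Longrightarrow> \<bar>Q_mem S t m u - Q_info S \<sigma> t p u\<bar> \<le> c"
  shows "\<bar>V_mem S t m - V_info S \<sigma> t p\<bar> \<le> c"
  using assms unfolding V_mem.simps V_info.simps minimax_problem_wf_def
  by (intro abs_Min_image_diff_le) auto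

text \<open>One step of the recursion for \<alpha>: \<open>c\<close>, \<open>l\<close> and
  \<open>r\<close> stand for \<open>\<alpha> (Suc t)\<close>, \<open>L (Suc t)\<close> and
  \<open>\<delta> t\<close>, and \<open>P\<close> for the metric at time \<open>Suc t\<close>. The
  triangle inequality passes through the maximum of \<open>?V\<close> over
  \<open>?A\<close>.\<close>

lemma abs_Q_diff_step:
  assumes wf: "minimax_problem_wf S"
    and t: "t < horizon S"
    and m: "m \<in> memories S t" and u: "u \<in> actions S t"
    and haus: "hausdorff_dist (mdist P)
          (cond_range S (info_var S \<sigma> (Suc t)) (mem_action_var S t) (m, u))
          (cond_range S (info_var S \<sigma> (Suc t)) (info_action_var S \<sigma> t) (\<sigma> t m, u)) \<le> r"
    and lip: "lipschitz_const_on P (info_var S \<sigma> (Suc t) ` sample_space S)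
             (V_info S \<sigma> (Suc t)) l"
    and next_diff: "\<And>m'. m' \<in> memories S (Suc t) \<Longrightarrow>
          \<bar>V_mem S (Suc t) m' - V_info S \<sigma> (Suc t) (\<sigma> (Suc t) m')\<bar> \<le> c"
  shows "\<bar>Q_mem S t m u - Q_info S \<sigma> t (\<sigma> t m) u\<bar> \<le> c + l * r"
proof -
  let ?M = "cond_range S (mem_var S (Suc t)) (mem_action_var S t) (m, u)"
  let ?A = "cond_range S (info_var S \<sigma> (Suc t)) (mem_action_var S t) (m, u)"
  let ?B = "cond_range S (info_var S \<sigma> (Suc t)) (info_action_var S \<sigma> t) (\<sigma> t m, u)"
  let ?V = "V_info S \<sigma> (Suc t)"
  obtain \<omega> where \<omega>: "\<omega> \<in> sample_space S" "mem_action_var S t \<omega> = (m, u)"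
    using ex_sample_mem_action[OF _ m u] t by auto
  \<comment> \<open>The same sample satisfies the coarser condition, so it witnesses all three
    ranges.\<close>
  then have "info_action_var S \<sigma> t \<omega> = (\<sigma> t m, u)"
    by (simp add: mem_action_var_def info_action_var_def info_var_def)
  then have ne: "?M \<noteq> {}" "?A \<noteq> {}" "?B \<noteq> {}"
    using \<omega> by (simp_all add: cond_range_nonempty)
  note fin = finite_cond_range[OF wf]
  have "\<bar>Max (V_mem S (Suc t) ` ?M) - Max ((\<lambda>m'. ?V (\<sigma> (Suc t) m')) ` ?M)\<bar> \<le> c"
  proof (rule abs_Max_image_diff_le[OF fin ne(1) fin ne(1)])
    fix m' assume "m' \<in> ?M"
    then have "\<bar>V_mem S (Suc t) m' - ?V (\<sigma> (Suc t) m')\<bar> \<le> c"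
      using cond_range_subset next_diff unfolding memories_def by fast
    with \<open>m' \<in> ?M\<close> show "\<exists>b\<in>?M. \<bar>V_mem S (Suc t) m' - ?V (\<sigma> (Suc t) b)\<bar> \<le> c"
      and "\<exists>a\<in>?M. \<bar>V_mem S (Suc t) a - ?V (\<sigma> (Suc t) m')\<bar> \<le> c" by blast+
  qed
  moreover have "(\<lambda>m'. ?V (\<sigma> (Suc t) m')) ` ?M = ?V ` ?A"
    by (simp add: cond_range_info_var image_image)
  moreover have "\<bar>Max (?V ` ?A) - Max (?V ` ?B)\<bar> \<le> l * r"
    by (rule lipschitz_Max_diff_le[OF lip cond_range_subset cond_range_subset
          fin ne(2) fin ne(3) haus])
  ultimately show ?thesis
    using t by (simp add: Q_mem.simps[of S t] Q_info.simps[of S \<sigma> t])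
qed

theorem theorem2:
  fixes S :: "('x, 'u, 'w, 'n, 'y) minimax_problem"
    and P :: "nat \<Rightarrow> 'p metric"
    and \<sigma> :: "nat \<Rightarrow> ('u, 'y) memory \<Rightarrow> 'p"
    and \<epsilon> :: real
    and \<delta> L \<alpha> :: "nat \<Rightarrow> real"
  assumes "minimax_problem_wf S"
    and "approx_info_state S P \<sigma> \<epsilon> \<delta>"
    and "\<And>t. t < horizon S \<Longrightarrow>
           lipschitz_const_on (P (Suc t)) (info_var S \<sigma> (Suc t) ` sample_space S)
             (V_info S \<sigma> (Suc t)) (L (Suc t))"
    and "\<alpha> (horizon S) = \<epsilon>"
    and "\<And>t. t < horizon S \<Longrightarrow> \<alpha> t = \<alpha> (Suc t) + L (Suc t) * \<delta> t"
  shows "\<forall>t\<le>horizon S. \<forall>m\<in>memories S t. \<forall>u\<in>actions S t.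
           \<bar>Q_mem S t m u - Q_info S \<sigma> t (\<sigma> t m) u\<bar> \<le> \<alpha> t \<and>
           \<bar>V_mem S t m - V_info S \<sigma> t (\<sigma> t m)\<bar> \<le> \<alpha> t"
proof -
  \<comment> \<open>The bound on Q suffices for the induction: the bound on V at the same time
    follows with the same constant.\<close>
  have "\<forall>m\<in>memories S t. \<forall>u\<in>actions S t. \<bar>Q_mem S t m u - Q_info S \<sigma> t (\<sigma> t m) u\<bar> \<le> \<alpha> t"
    if "t \<le> horizon S" for t
    using that
  proof (induction t rule: inc_induct)
    \<comment> \<open>At the horizon both Q functions unfold to maxima of the terminal cost, whose
      difference the first approximation condition bounds by \<epsilon>.\<close>
    case base
    then show ?case
      using assms(2,4)
      by (simp add: Q_mem.simps[of S "horizon S"] Q_info.simps[of S \<sigma> "horizon S"]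
          approx_info_state_def)
  next
    case (step t)
    have "\<bar>V_mem S (Suc t) m - V_info S \<sigma> (Suc t) (\<sigma> (Suc t) m)\<bar> \<le> \<alpha> (Suc t)"
      if "m \<in> memories S (Suc t)" for m
      using step that by (intro abs_V_diff_le[OF assms(1)]) auto
    then show ?case
      using abs_Q_diff_step[OF assms(1) step(2) _ _ _ assms(3)[OF step(2)]]
        assms(2) step(2) unfolding assms(5)[OF step(2)] approx_info_state_def by blast
  qed
  then show ?thesis
    by (auto intro: abs_V_diff_le[OF assms(1)])
qed

end
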